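(* Let $\mathcal{V}_1,\mathcal{V}_2$ be two Banach spaces and let $\gamma_i:[0,1]\to\mathcal{V}_i$, $i=1,2$, be two continuous paths. Suppose there exist $p>1$, $q>1$ with $p^{-1}+q^{-1}=1$, and two non-decreasing functions $m_i:[0,1]\to[0,\infty)$, $i=1,2$, satisfying $$\lim_{t\to0}m_i(t)=0,\quad m_i(1)\le1\ (i=1,2),\quad\text{and}\quad\int_0^1\frac{m_1(t)m_2(t)}{t}\,dt<\infty,$$ such that $$C_1:=\sup_{0\le s<t\le1}\frac{\|\gamma_1(t)-\gamma_1(s)\|}{|t-s|^{1/p}m_1(t-s)}<\infty,\qquad C_2:=\sup_{0\le s<t\le1}\frac{\|\gamma_2(t)-\gamma_2(s)\|}{|t-s|^{1/q}m_2(t-s)}<\infty.$$ Then the Riemann–Stieltjes integral $\int_0^t\gamma_1(u)\otimes d\gamma_2(u)$ exists for $t\in[0,1]$, and $$\left\|\int_0^{\cdot}\gamma_1(u)\otimes d\gamma_2(u)\right\|_{q-var}\le 8C_1C_2\left(2+\int_0^1\frac{m_1(t)m_2(t)}{t}\,dt\right).$$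
   Context: $\mathcal{V}_1\otimes\mathcal{V}_2$ is the Banach space obtained as the completion of the algebraic tensor product in a norm satisfying $\|v\otimes u\|\le\|v\|\|u\|$. The Riemann–Stieltjes integral is the limit, as the mesh of finite partitions $\{t_j\}$ tends to $0$, of the Riemann sums $\sum_j\gamma_1(\xi_j)\otimes(\gamma_2(t_{j+1})-\gamma_2(t_j))$, $\xi_j\in[t_j,t_{j+1}]$. For a continuous path $\eta:[0,1]\to\mathcal W$ in a Banach space, $\|\eta\|_{q-var}=(\sup_{D}\sum_{j}\|\eta(t_{j+1})-\eta(t_j)\|^q)^{1/q}$, the supremum being over all finite partitions $D=\{t_j\}$ of $[0,1]$.
   Formalization: The q-variation bound is stated only for γ₁(0)=0; without this it fails (γ₁≡1, γ₂(t)=t, p=q=2, m₁=m₂=√t gives C₁=0 but the integral t has 2-variation 1). Existence of the integral is stated without this condition. *)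

theory Defs
  imports "HOL-Analysis.Analysis" "HOL-Library.Poly_Mapping"
begin

instantiation poly_mapping :: (type, real_vector) real_vector
begin

lift_definition scaleR_poly_mapping :: "real \<Rightarrow> ('a \<Rightarrow>\<^sub>0 'b) \<Rightarrow> ('a \<Rightarrow>\<^sub>0 'b)"
  is "\<lambda>r f k. r *\<^sub>R f k"
  by (erule rev_finite_subset) auto

instance
  by standard (transfer; simp add: fun_eq_iff scaleR_add_right scaleR_add_left)+

end

text \<open>The free real vector space on \<open>'a \<times> 'b\<close> is \<^typ>\<open>('a \<times> 'b) \<Rightarrow>\<^sub>0 real\<close>, with basis vectors
  \<open>Poly_Mapping.single (v, u) 1\<close>; the tensor product is its quotient by the span of the
  bilinearity relations.\<close>

definition tensor_relations :: "(('a::real_vector \<times> 'b::real_vector) \<Rightarrow>\<^sub>0 real) set" where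
  "tensor_relations =
     {Poly_Mapping.single (v + v', u) 1 - Poly_Mapping.single (v, u) 1
        - Poly_Mapping.single (v', u) 1 | v v' u. True} \<union>
     {Poly_Mapping.single (v, u + u') 1 - Poly_Mapping.single (v, u) 1
        - Poly_Mapping.single (v, u') 1 | v u u'. True} \<union>
     {Poly_Mapping.single (r *\<^sub>R v, u) 1 - r *\<^sub>R Poly_Mapping.single (v, u) 1 | r v u. True} \<union>
     {Poly_Mapping.single (v, r *\<^sub>R u) 1 - r *\<^sub>R Poly_Mapping.single (v, u) 1 | r v u. True}"

definition tensor_equiv ::
  "(('a::real_vector \<times> 'b::real_vector) \<Rightarrow>\<^sub>0 real) \<Rightarrow> (('a \<times> 'b) \<Rightarrow>\<^sub>0 real) \<Rightarrow> bool" where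
  "tensor_equiv x y \<longleftrightarrow> x - y \<in> span tensor_relations"

lemma equivp_tensor_equiv:
  "equivp (tensor_equiv :: (('a::real_vector \<times> 'b::real_vector) \<Rightarrow>\<^sub>0 real) \<Rightarrow> _)"
proof (intro equivpI reflpI sympI transpI)
  fix x y z :: "('a \<times> 'b) \<Rightarrow>\<^sub>0 real"
  show "tensor_equiv x x"
    by (simp add: tensor_equiv_def span_zero)
  show "tensor_equiv y x" if "tensor_equiv x y"
    using span_neg[OF that[unfolded tensor_equiv_def]] by (simp add: tensor_equiv_def)
  show "tensor_equiv x z" if "tensor_equiv x y" "tensor_equiv y z"
    using span_add[OF that[unfolded tensor_equiv_def]] by (simp add: tensor_equiv_def)
qed

quotient_type (overloaded) ('a, 'b) tensor =
  "('a::real_vector \<times> 'b::real_vector) \<Rightarrow>\<^sub>0 real" / tensor_equiv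
  by (rule equivp_tensor_equiv)

instantiation tensor :: (real_vector, real_vector) real_vector
begin

lift_definition zero_tensor :: "('a, 'b) tensor" is 0 .

lift_definition plus_tensor :: "('a, 'b) tensor \<Rightarrow> ('a, 'b) tensor \<Rightarrow> ('a, 'b) tensor" is "(+)"
  unfolding tensor_equiv_def by (metis add_diff_add span_add)

lift_definition minus_tensor :: "('a, 'b) tensor \<Rightarrow> ('a, 'b) tensor \<Rightarrow> ('a, 'b) tensor" is "(-)"
  unfolding tensor_equiv_def
proof -
  fix x y x' y' :: "('a \<times> 'b) \<Rightarrow>\<^sub>0 real"
  assume "x - y \<in> span tensor_relations" "x' - y' \<in> span tensor_relations"
  then have "(x - y) - (x' - y') \<in> span tensor_relations" by (rule span_diff)
  then show "(x - x') - (y - y') \<in> span tensor_relations" by (simp add: algebra_simps)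
qed

lift_definition uminus_tensor :: "('a, 'b) tensor \<Rightarrow> ('a, 'b) tensor" is uminus
  unfolding tensor_equiv_def by (metis minus_diff_minus span_neg)

lift_definition scaleR_tensor :: "real \<Rightarrow> ('a, 'b) tensor \<Rightarrow> ('a, 'b) tensor" is "scaleR"
  unfolding tensor_equiv_def by (metis scaleR_diff_right span_scale)

instance
  by standard (transfer; simp add: tensor_equiv_def span_zero algebra_simps)+

end

lift_definition tensor_prod :: "'a::real_vector \<Rightarrow> 'b::real_vector \<Rightarrow> ('a, 'b) tensor"
    (infixr \<open>\<otimes>\<^sub>t\<close> 75)
  is "\<lambda>v u. Poly_Mapping.single (v, u) 1" .

text \<open>A completion of the algebraic tensor product is presented as a Banach space together with a
  linear embedding \<open>\<iota>\<close> of the tensor product onto a dense subspace; the norm on the tensor product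
  is \<open>\<lambda>x. norm (\<iota> x)\<close>.\<close>

definition tensor_completion ::
  "(('a::real_normed_vector, 'b::real_normed_vector) tensor \<Rightarrow> 'c::banach) \<Rightarrow> bool" where
  "tensor_completion \<iota> \<longleftrightarrow>
     linear \<iota> \<and> inj \<iota> \<and> closure (\<iota> ` UNIV) = UNIV \<and>
     (\<forall>v u. norm (\<iota> (v \<otimes>\<^sub>t u)) \<le> norm v * norm u)"

definition finite_partition :: "real \<Rightarrow> real \<Rightarrow> nat \<Rightarrow> (nat \<Rightarrow> real) \<Rightarrow> bool" where
  "finite_partition a b n \<tau> \<longleftrightarrow> \<tau> 0 = a \<and> \<tau> n = b \<and> (\<forall>j<n. \<tau> j < \<tau> (Suc j))"

definition has_RS_integral ::
  "('a \<Rightarrow> 'b \<Rightarrow> 'c) \<Rightarrow> (real \<Rightarrow> 'a) \<Rightarrow> (real \<Rightarrow> 'b::real_normed_vector) \<Rightarrow> real \<Rightarrow> real \<Rightarrow>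
    'c::real_normed_vector \<Rightarrow> bool" where
  "has_RS_integral B f g a b I \<longleftrightarrow>
     (\<forall>\<epsilon>>0. \<exists>\<delta>>0. \<forall>n \<tau> \<xi>.
        finite_partition a b n \<tau> \<longrightarrow>
        (\<forall>j<n. \<tau> (Suc j) - \<tau> j < \<delta>) \<longrightarrow>
        (\<forall>j<n. \<xi> j \<in> {\<tau> j..\<tau> (Suc j)}) \<longrightarrow>
        norm ((\<Sum>j<n. B (f (\<xi> j)) (g (\<tau> (Suc j)) - g (\<tau> j))) - I) < \<epsilon>)"

definition RS_integrable ::
  "('a \<Rightarrow> 'b \<Rightarrow> 'c::real_normed_vector) \<Rightarrow> (real \<Rightarrow> 'a) \<Rightarrow> (real \<Rightarrow> 'b::real_normed_vector) \<Rightarrow>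
    real \<Rightarrow> real \<Rightarrow> bool" where
  "RS_integrable B f g a b \<longleftrightarrow> (\<exists>I. has_RS_integral B f g a b I)"

definition RS_integral ::
  "('a \<Rightarrow> 'b \<Rightarrow> 'c) \<Rightarrow> (real \<Rightarrow> 'a) \<Rightarrow> (real \<Rightarrow> 'b::real_normed_vector) \<Rightarrow> real \<Rightarrow> real \<Rightarrow>
    'c::real_normed_vector" where
  "RS_integral B f g a b = (THE I. has_RS_integral B f g a b I)"

text \<open>Extended-valued, so that an upper bound on the variation asserts its finiteness.  The case
  distinction is needed because \<open>enn2real top = 0\<close>.\<close>

definition q_variation :: "real \<Rightarrow> (real \<Rightarrow> 'a::real_normed_vector) \<Rightarrow> ennreal" where
  "q_variation q \<eta> =
     (let S = (SUP (n, \<tau>) \<in> {(n, \<tau>). finite_partition 0 1 n \<tau>}.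
                 ennreal (\<Sum>j<n. norm (\<eta> (\<tau> (Suc j)) - \<eta> (\<tau> j)) powr q))
      in if S = top then top else ennreal (enn2real S powr (1 / q)))"

text \<open>The quotient is taken in \<^typ>\<open>ennreal\<close>, where \<open>x / 0 = top\<close> for \<open>x \<noteq> 0\<close> and \<open>0 / 0 = 0\<close>: where
  \<open>m (t - s)\<close> vanishes, a finite supremum still forces \<open>\<gamma> t = \<gamma> s\<close>.  (In \<^typ>\<open>real\<close> the quotient
  would be \<open>0\<close>.)\<close>

definition modulus_const ::
  "real \<Rightarrow> (real \<Rightarrow> real) \<Rightarrow> (real \<Rightarrow> 'a::real_normed_vector) \<Rightarrow> ennreal" where
  "modulus_const p m \<gamma> =
     (SUP (s, t) \<in> {(s, t). 0 \<le> s \<and> s < t \<and> t \<le> 1}.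
        ennreal (norm (\<gamma> t - \<gamma> s)) / ennreal (\<bar>t - s\<bar> powr (1 / p) * m (t - s)))"

end

theory Submission
  imports Defs
begin

text \<open>The integral is built by dyadic sewing.  Left Riemann sums over the dyadic grid of level \<open>l\<close>,
  restricted to \<open>[s, t]\<close>, change under refinement by at most (number of cells meeting \<open>[s, t]\<close>)
  \<open>\<times> C\<^sub>1 C\<^sub>2 2\<^sup>-\<^sup>l m\<^sub>1(2\<^sup>-\<^sup>l) m\<^sub>2(2\<^sup>-\<^sup>l)\<close>, because \<open>1/p + 1/q = 1\<close>.  Comparing with the integral of
  \<open>m\<^sub>1 m\<^sub>2 / t\<close> over dyadic intervals, these bounds are summable, so the sums over \<open>[0, t]\<close> converge to
  some \<open>I t\<close>.  Starting at the level \<open>N\<close> with \<open>2\<^sup>-\<^sup>N\<close> comparable to \<open>h = t - s\<close> gives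
  \<open>\<parallel>I t - I s - \<gamma>\<^sub>1 s \<otimes> (\<gamma>\<^sub>2 t - \<gamma>\<^sub>2 s)\<parallel> \<le> h R(N)\<close> with \<open>R(N) \<rightarrow> 0\<close>.  Summed over the cells of an arbitrary
  partition, this identifies \<open>I\<close> as the Riemann-Stieltjes integral; together with
  \<open>\<parallel>\<gamma>\<^sub>1 s\<parallel> \<le> C\<^sub>1\<close> it yields \<open>\<parallel>I t - I s\<parallel> \<le> K h\<^bsup>1/q\<^esup>\<close>, and hence the variation bound.\<close>

section \<open>The tensor product as a bounded bilinear map\<close>

text \<open>Each bilinearity law holds in the quotient because the difference of its two sides is a
  generator in \<open>tensor_relations\<close>. The bounding constant 1 is the cross-norm
  inequality. From here on only a bounded bilinear map is needed.\<close>

lemma bounded_bilinear_tensor_completion: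
  assumes "tensor_completion \<iota>"
  shows "bounded_bilinear (\<lambda>v u. \<iota> (v \<otimes>\<^sub>t u))"
proof -
  interpret linear \<iota>
    using assms by (simp add: tensor_completion_def)
  have 1: "(v + v') \<otimes>\<^sub>t u = v \<otimes>\<^sub>t u + v' \<otimes>\<^sub>t u" for v v' :: 'a and u :: 'b
    by transfer (unfold tensor_equiv_def diff_diff_eq[symmetric], rule span_base, unfold tensor_relations_def, blast)
  have 2: "v \<otimes>\<^sub>t (u + u') = v \<otimes>\<^sub>t u + v \<otimes>\<^sub>t u'" for v :: 'a and u u' :: 'b
    by transfer (unfold tensor_equiv_def diff_diff_eq[symmetric], rule span_base, unfold tensor_relations_def, blast)
  have 3: "(r *\<^sub>R v) \<otimes>\<^sub>t u = r *\<^sub>R (v \<otimes>\<^sub>t u)" for r and v :: 'a and u :: 'b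
    by transfer (unfold tensor_equiv_def, rule span_base, unfold tensor_relations_def, blast)
  have 4: "v \<otimes>\<^sub>t (r *\<^sub>R u) = r *\<^sub>R (v \<otimes>\<^sub>t u)" for r and v :: 'a and u :: 'b
    by transfer (unfold tensor_equiv_def, rule span_base, unfold tensor_relations_def, blast)
  show ?thesis
    using assms
    by unfold_locales
      (auto simp: 1 2 3 4 add scaleR tensor_completion_def intro!: exI[of _ 1])
qed

section \<open>Finite partitions and uniqueness of the Riemann-Stieltjes integral\<close>

lemma finite_partition_mono:
  assumes "finite_partition a b n \<tau>" "i \<le> j" "j \<le> n"
  shows "\<tau> i \<le> \<tau> j"
  using assms(2,3)
proof (induction j rule: dec_induct)
  case (step k)
  then show ?case
    using assms(1) by (meson Suc_le_eq finite_partition_def less_imp_le order_trans)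
qed simp

lemma finite_partition_bounds:
  assumes "finite_partition a b n \<tau>" "j \<le> n"
  shows "\<tau> j \<in> {a..b}"
  using finite_partition_mono[OF assms(1), of 0 j] finite_partition_mono[OF assms(1), of j n] assms
  by (auto simp: finite_partition_def)

lemma finite_partition_telescope:
  fixes F :: "real \<Rightarrow> 'a::ab_group_add"
  assumes "finite_partition a b n \<tau>"
  shows "(\<Sum>j<n. F (\<tau> (Suc j)) - F (\<tau> j)) = F b - F a"
  using assms by (simp add: sum_lessThan_telescope[of "\<lambda>j. F (\<tau> j)"] finite_partition_def)

text \<open>Keeps the limit over the mesh from being vacuous, which uniqueness of the integral
  relies on.\<close>

lemma exists_fine_partition:
  assumes "a \<le> b" "\<delta> > 0"
  shows "\<exists>n \<tau>. finite_partition a b n \<tau> \<and> (\<forall>j<n. \<tau> (Suc j) - \<tau> j < \<delta>)"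
proof (cases "a = b")
  \<comment> \<open>Partition points increase strictly, so a degenerate interval has only the
    partition without cells.\<close>
  case True
  then show ?thesis
    by (intro exI[of _ 0] exI[of _ "\<lambda>_. a"]) (simp add: finite_partition_def)
next
  case False
  obtain n where n: "(b - a) / \<delta> < real n"
    using reals_Archimedean2 by blast
  have "0 < (b - a) / \<delta>"
    using False assms by simp
  then have n0: "real n > 0"
    using n by linarith
  define \<tau> where "\<tau> j = a + real j * ((b - a) / n)" for j
  have step: "\<tau> (Suc j) - \<tau> j = (b - a) / n" for j
    by (simp add: \<tau>_def distrib_right add_divide_distrib)
  have less: "(b - a) / n < \<delta>"
    using n n0 assms by (simp add: field_simps)
  have "0 < (b - a) / n"
    using False assms n0 by simp
  then have "\<tau> j < \<tau> (Suc j)" for j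
    using step[of j] by linarith
  moreover have "\<tau> 0 = a" "\<tau> n = b"
    using n0 by (simp_all add: \<tau>_def)
  ultimately have "finite_partition a b n \<tau>"
    by (simp add: finite_partition_def)
  moreover have "\<forall>j<n. \<tau> (Suc j) - \<tau> j < \<delta>"
    using step less by simp
  ultimately show ?thesis by blast
qed

text \<open>One partition finer than both thresholds, tagged at its left endpoints, gives a Riemann
  sum closer than half of \<open>norm (I - I')\<close> to both candidates. This justifies the
  \<open>THE\<close> in \<open>RS_integral\<close>.\<close>

lemma has_RS_integral_unique:
  assumes "a \<le> b" "has_RS_integral B f g a b I" "has_RS_integral B f g a b I'"
  shows "I = I'"
proof (rule ccontr)
  assume "I \<noteq> I'"
  define e where "e = norm (I - I') / 2"
  have e: "e > 0"
    using \<open>I \<noteq> I'\<close> by (simp add: e_def)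
  let ?S = "\<lambda>n \<tau> \<xi>. \<Sum>j<n. B (f (\<xi> j)) (g (\<tau> (Suc j)) - g (\<tau> j))"
  let ?close = "\<lambda>\<delta> L. \<delta> > 0 \<and> (\<forall>n \<tau> \<xi>. finite_partition a b n \<tau> \<longrightarrow>
    (\<forall>j<n. \<tau> (Suc j) - \<tau> j < \<delta>) \<longrightarrow> (\<forall>j<n. \<xi> j \<in> {\<tau> j..\<tau> (Suc j)}) \<longrightarrow>
    norm (?S n \<tau> \<xi> - L) < e)"
  obtain d where d: "?close d I"
    using assms(2)[unfolded has_RS_integral_def, THEN spec, THEN mp, OF e] by (elim exE)
  obtain d' where d': "?close d' I'"
    using assms(3)[unfolded has_RS_integral_def, THEN spec, THEN mp, OF e] by (elim exE)
  obtain n \<tau> where P: "finite_partition a b n \<tau>" "\<forall>j<n. \<tau> (Suc j) - \<tau> j < min d d'"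
    using exists_fine_partition[OF assms(1), of "min d d'"] d d' by auto
  have tag: "\<forall>j<n. \<tau> j \<in> {\<tau> j..\<tau> (Suc j)}"
    using P(1) by (auto simp: finite_partition_def less_imp_le)
  have "norm (?S n \<tau> \<tau> - I) < e"
    using P(2) by (intro d[THEN conjunct2, rule_format, OF P(1)] tag[rule_format]) auto
  moreover have "norm (?S n \<tau> \<tau> - I') < e"
    using P(2) by (intro d'[THEN conjunct2, rule_format, OF P(1)] tag[rule_format]) auto
  moreover have "norm (I - I') \<le> norm (?S n \<tau> \<tau> - I') + norm (?S n \<tau> \<tau> - I)"
    using norm_triangle_ineq4[of "?S n \<tau> \<tau> - I'" "?S n \<tau> \<tau> - I"] by simp
  ultimately show False
    by (simp add: e_def)
qed

lemma RS_integral_eq: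
  assumes "a \<le> b" "has_RS_integral B f g a b I"
  shows "RS_integral B f g a b = I"
  unfolding RS_integral_def using assms has_RS_integral_unique by blast

text \<open>The q-th power of a bound with exponent 1/q is linear in the length of the cell, so over
  any partition of the unit interval the powers sum to at most \<open>K powr q\<close>.\<close>

lemma q_variation_le:
  assumes q: "q > 0" and K: "K \<ge> 0"
    and le: "\<And>s t. 0 \<le> s \<Longrightarrow> s < t \<Longrightarrow> t \<le> 1 \<Longrightarrow> norm (\<eta> t - \<eta> s) \<le> K * (t - s) powr (1 / q)"
  shows "q_variation q \<eta> \<le> ennreal K"
proof -
  define S where "S = (SUP (n, \<tau>) \<in> {(n, \<tau>). finite_partition 0 1 n \<tau>}.
                 ennreal (\<Sum>j<n. norm (\<eta> (\<tau> (Suc j)) - \<eta> (\<tau> j)) powr q))"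
  have "(\<Sum>j<n. norm (\<eta> (\<tau> (Suc j)) - \<eta> (\<tau> j)) powr q) \<le> K powr q"
    if P: "finite_partition 0 1 n \<tau>" for n \<tau>
  proof -
    have "norm (\<eta> (\<tau> (Suc j)) - \<eta> (\<tau> j)) powr q \<le> K powr q * (\<tau> (Suc j) - \<tau> j)" if "j < n" for j
    proof -
      have j: "\<tau> j < \<tau> (Suc j)" "0 \<le> \<tau> j" "\<tau> (Suc j) \<le> 1"
        using P that finite_partition_bounds[OF P, of j] finite_partition_bounds[OF P, of "Suc j"]
        by (auto simp: finite_partition_def)
      then have "norm (\<eta> (\<tau> (Suc j)) - \<eta> (\<tau> j)) powr q \<le> (K * (\<tau> (Suc j) - \<tau> j) powr (1 / q)) powr q"
        using q by (intro powr_mono2 le) auto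
      also have "\<dots> = K powr q * (\<tau> (Suc j) - \<tau> j)"
        using j q K by (simp add: powr_mult powr_powr)
      finally show ?thesis .
    qed
    then have "(\<Sum>j<n. norm (\<eta> (\<tau> (Suc j)) - \<eta> (\<tau> j)) powr q)
        \<le> (\<Sum>j<n. K powr q * (\<tau> (Suc j) - \<tau> j))"
      by (intro sum_mono) simp
    also have "\<dots> = K powr q"
      using finite_partition_telescope[OF P, of "\<lambda>x. x"] by (simp flip: sum_distrib_left)
    finally show ?thesis .
  qed
  then have S: "S \<le> ennreal (K powr q)"
    unfolding S_def by (intro SUP_least) (auto intro: ennreal_leI)
  \<comment> \<open>Finiteness must be settled first: it selects the real-valued branch in
    \<open>q_variation\<close>.\<close>
  then have "S \<noteq> top"
    using ennreal_less_top leD top.not_eq_extremum by blast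
  have "enn2real S \<le> K powr q"
    using S by (simp add: enn2real_leI)
  then have "enn2real S powr (1 / q) \<le> (K powr q) powr (1 / q)"
    using q by (intro powr_mono2) auto
  also have "\<dots> = K"
    using q K by (simp add: powr_powr)
  finally show ?thesis
    using \<open>S \<noteq> top\<close> unfolding q_variation_def S_def[symmetric] Let_def
    by (simp add: ennreal_leI)
qed

text \<open>Since \<^typ>\<open>ennreal\<close> division by zero is \<open>top\<close> unless the numerator vanishes, finiteness of
  the supremum gives the estimate also where \<open>m (t - s) = 0\<close>.\<close>

lemma norm_diff_le_modulus_const:
  assumes fin: "modulus_const p m \<gamma> < top" and st: "0 \<le> s" "s < t" "t \<le> 1"
    and m: "m (t - s) \<ge> 0"
  shows "norm (\<gamma> t - \<gamma> s) \<le> enn2real (modulus_const p m \<gamma>) * ((t - s) powr (1 / p) * m (t - s))"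
proof -
  let ?C = "modulus_const p m \<gamma>" and ?d = "(t - s) powr (1 / p) * m (t - s)"
  have d: "?d \<ge> 0"
    using m by simp
  have le: "ennreal (norm (\<gamma> t - \<gamma> s)) / ennreal ?d \<le> ?C"
    unfolding modulus_const_def using st by (intro SUP_upper2[of "(s, t)"]) auto
  show ?thesis
  proof (cases "?d = 0")
    case True
    have "norm (\<gamma> t - \<gamma> s) = 0"
    proof (rule ccontr)
      assume "norm (\<gamma> t - \<gamma> s) \<noteq> 0"
      then have "ennreal (norm (\<gamma> t - \<gamma> s)) / ennreal ?d = top"
        unfolding True by simp
      then show False using le fin by simp
    qed
    then show ?thesis
      unfolding True by simp
  next
    case False
    then have d0: "?d > 0"
      using d by linarith
    have "norm (\<gamma> t - \<gamma> s) / ?d = enn2real (ennreal (norm (\<gamma> t - \<gamma> s)) / ennreal ?d)"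
      using d0 by (simp add: divide_ennreal)
    also have "\<dots> \<le> enn2real ?C"
      using le fin by (rule enn2real_mono)
    finally show ?thesis
      using d0 by (simp add: pos_divide_le_eq)
  qed
qed

section \<open>Counting grid cells and choosing a dyadic scale\<close>

lemma sum_lessThan_double:
  fixes F :: "nat \<Rightarrow> 'a::comm_monoid_add"
  shows "(\<Sum>k<2 * n. F k) = (\<Sum>k<n. F (2 * k) + F (2 * k + 1))"
  by (induction n) (simp_all add: add.assoc)

lemma card_nat_interval_le:
  fixes A :: "nat set" and c :: real
  assumes "finite A" "c \<ge> 0" "\<And>i j. i \<in> A \<Longrightarrow> j \<in> A \<Longrightarrow> real j - real i \<le> c"
  shows "real (card A) \<le> c + 1"
proof (cases "A = {}")
  case False
  have "card A \<le> card {Min A..Max A}"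
    using assms(1) by (intro card_mono) auto
  moreover have "Min A \<le> Max A"
    using assms(1) False by simp
  ultimately have "real (card A) \<le> real (Max A) - real (Min A) + 1"
    by (simp add: of_nat_diff)
  then show ?thesis
    using assms(3)[of "Min A" "Max A"] assms(1) False by simp
qed (use assms in simp)

text \<open>At most \<open>(t - s) / H + 2\<close> cells of a grid of width \<open>H\<close> meet the interior of \<open>[s, t]\<close>.\<close>

lemma norm_sum_grid_le:
  fixes e :: "nat \<Rightarrow> 'c::real_normed_vector"
  assumes H: "H > 0" and st: "s \<le> t" and E: "E \<ge> 0"
    and le: "\<And>k. k < n \<Longrightarrow> real k * H < t \<Longrightarrow> s < (real k + 1) * H \<Longrightarrow> norm (e k) \<le> E"
    and zero: "\<And>k. k < n \<Longrightarrow> t \<le> real k * H \<or> (real k + 1) * H \<le> s \<Longrightarrow> e k = 0"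
  shows "norm (\<Sum>k<n. e k) \<le> ((t - s) / H + 2) * E"
proof -
  define A where "A = {k. k < n \<and> real k * H < t \<and> s < (real k + 1) * H}"
  have "real (card A) \<le> ((t - s) / H + 1) + 1"
  proof (rule card_nat_interval_le)
    fix i j assume "i \<in> A" "j \<in> A"
    \<comment> \<open>Cell \<open>j\<close> starts before \<open>t\<close> and cell \<open>i\<close>
      ends after \<open>s\<close>. Passing from the right end of cell \<open>i\<close> to its index
      costs one unit, and counting both extreme indices costs another; hence the 2 in the
      bound.\<close>
    then have "real j * H - (real i + 1) * H < t - s"
      by (auto simp: A_def)
    then show "real j - real i \<le> (t - s) / H + 1"
      using H by (simp add: field_simps)
  qed (use H st in \<open>auto simp: A_def\<close>)
  moreover have "(\<Sum>k<n. e k) = (\<Sum>k\<in>A. e k)"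
    by (rule sum.mono_neutral_right) (auto simp: A_def not_less intro!: zero)
  moreover have "norm (\<Sum>k\<in>A. e k) \<le> real (card A) * E"
    by (rule sum_norm_bound) (auto simp: A_def intro: le)
  ultimately show ?thesis
    using mult_right_mono[OF _ E, of "real (card A)" "(t - s) / H + 2"] by simp
qed

text \<open>\<open>N\<close> precedes the least exponent whose power of 1/2 falls below
  \<open>h\<close>. The first inequality lets increments over length \<open>h\<close> be estimated
  at level \<open>N\<close>; the second lets errors of size 2^-N be charged to
  \<open>h\<close>.\<close>

lemma exists_dyadic_scale:
  fixes h :: real
  assumes "0 < h" "h \<le> 1"
  obtains N :: nat where "h \<le> 1 / 2 ^ N" "1 / 2 ^ N < 2 * h"
proof -
  obtain n0 where "(1 / 2) ^ n0 < h"
    using real_arch_pow_inv[of h "1 / 2"] assms by auto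
  then have ex: "\<exists>n. (1 / 2) ^ n < h" by blast
  define n where "n = (LEAST n. (1 / 2 :: real) ^ n < h)"
  have n: "(1 / 2) ^ n < h"
    unfolding n_def by (rule LeastI_ex) fact
  \<comment> \<open>The exponent 0 is excluded by \<open>h \<le> 1\<close>.\<close>
  obtain N where N: "n = Suc N"
    using n assms by (cases n) auto
  have "\<not> (1 / 2) ^ N < h"
    using not_less_Least[of N "\<lambda>n. (1 / 2 :: real) ^ n < h"] N n_def by simp
  with n N show thesis
    by (intro that[of N]) (auto simp: power_one_over field_simps)
qed

section \<open>Dyadic sums for a bilinear pairing and their limit\<close>

text \<open>For \<open>s \<le> t\<close> this is the projection onto [s, t]. Clipping the grid
  points restricts a sum to [s, t] while its index set stays the same for all \<open>s\<close> and
  \<open>t\<close>.\<close>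

definition clip :: "real \<Rightarrow> real \<Rightarrow> real \<Rightarrow> real" where
  "clip s t x = max s (min t x)"

lemma clip_in: "0 \<le> s \<Longrightarrow> s \<le> t \<Longrightarrow> t \<le> 1 \<Longrightarrow> clip s t x \<in> {0..1}"
  by (auto simp: clip_def)

lemma clip_diff_le: "s \<le> t \<Longrightarrow> x \<le> y \<Longrightarrow> \<bar>clip s t y - clip s t x\<bar> \<le> y - x"
  by (auto simp: clip_def max_def min_def)

lemma clip_eq: "s \<le> t \<Longrightarrow> x \<le> y \<Longrightarrow> t \<le> x \<or> y \<le> s \<Longrightarrow> clip s t y = clip s t x"
  by (auto simp: clip_def max_def min_def)

text \<open>The sequences \<open>\<phi>\<close> and \<open>\<psi>\<close> bound the increments of
  \<open>f\<close> and \<open>g\<close> over distance 2^-l. The conjugacy of the exponents survives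
  only in the factor 2^-l of \<open>\<phi>\<psi>_le\<close>, and summability of \<open>a\<close>
  replaces the integral condition.\<close>

locale dyadic_integrands = bounded_bilinear B
  for B :: "'a::real_normed_vector \<Rightarrow> 'b::real_normed_vector \<Rightarrow> 'c::banach" +
  fixes f :: "real \<Rightarrow> 'a" and g :: "real \<Rightarrow> 'b" and \<phi> \<psi> a :: "nat \<Rightarrow> real"
  assumes norm_B: "norm (B v u) \<le> norm v * norm u"
    and f_le: "s \<in> {0..1} \<Longrightarrow> t \<in> {0..1} \<Longrightarrow> \<bar>t - s\<bar> \<le> 1 / 2 ^ l \<Longrightarrow> norm (f t - f s) \<le> \<phi> l"
    and g_le: "s \<in> {0..1} \<Longrightarrow> t \<in> {0..1} \<Longrightarrow> \<bar>t - s\<bar> \<le> 1 / 2 ^ l \<Longrightarrow> norm (g t - g s) \<le> \<psi> l"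
    and \<phi>\<psi>_le: "\<phi> l * \<psi> l \<le> a l / 2 ^ l"
    and summable_a: "summable a"
begin

lemma \<phi>_nonneg: "0 \<le> \<phi> l"
  using f_le[of 0 0 l] by simp

lemma \<psi>_nonneg: "0 \<le> \<psi> l"
  using g_le[of 0 0 l] by simp

lemma a_nonneg: "0 \<le> a l"
proof -
  have "0 \<le> a l / 2 ^ l"
    using \<phi>\<psi>_le[of l] \<phi>_nonneg[of l] \<psi>_nonneg[of l] by (meson mult_nonneg_nonneg order_trans)
  then show ?thesis
    by (simp add: pos_le_divide_eq)
qed

lemma norm_B_le:
  assumes "x \<in> {0..1}" "y \<in> {0..1}" "\<bar>y - x\<bar> \<le> 1 / 2 ^ l"
    "s \<in> {0..1}" "t \<in> {0..1}" "\<bar>t - s\<bar> \<le> 1 / 2 ^ l"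
  shows "norm (B (f y - f x) (g t - g s)) \<le> a l / 2 ^ l"
proof -
  have "norm (B (f y - f x) (g t - g s)) \<le> \<phi> l * \<psi> l"
    using norm_B by (rule order_trans) (intro mult_mono f_le g_le assms \<phi>_nonneg norm_ge_zero)
  then show ?thesis
    using \<phi>\<psi>_le[of l] by linarith
qed

text \<open>Only the argument of \<open>g\<close> is clipped. Since \<open>f\<close> is taken at the
  grid point itself, even one outside [s, t], the sums are exactly additive in the interval.\<close>

definition dyadic_sum :: "nat \<Rightarrow> real \<Rightarrow> real \<Rightarrow> 'c" where
  "dyadic_sum l s t =
     (\<Sum>k<2 ^ l. B (f (real k / 2 ^ l))
        (g (clip s t ((real k + 1) / 2 ^ l)) - g (clip s t (real k / 2 ^ l))))"

lemma dyadic_sum_diff: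
  assumes "0 \<le> s" "s \<le> t"
  shows "dyadic_sum l 0 t - dyadic_sum l 0 s = dyadic_sum l s t"
proof -
  \<comment> \<open>The remainder \<open>g s\<close> does not depend on \<open>x\<close>, so it
    cancels between the two ends of a cell.\<close>
  have *: "g (clip 0 t x) - g (clip 0 s x) = g (clip s t x) - g s" if "x \<ge> 0" for x
    using assms that by (auto simp: clip_def max_def min_def)
  have **: "(g (clip 0 t y) - g (clip 0 t x)) - (g (clip 0 s y) - g (clip 0 s x))
      = g (clip s t y) - g (clip s t x)" if "x \<ge> 0" "y \<ge> 0" for x y
  proof -
    have "(g (clip 0 t y) - g (clip 0 t x)) - (g (clip 0 s y) - g (clip 0 s x))
        = (g (clip 0 t y) - g (clip 0 s y)) - (g (clip 0 t x) - g (clip 0 s x))"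
      by simp
    also have "\<dots> = g (clip s t y) - g (clip s t x)"
      using *[OF that(1)] *[OF that(2)] by simp
    finally show ?thesis .
  qed
  show ?thesis
    unfolding dyadic_sum_def sum_subtractf[symmetric] diff_right[symmetric]
    by (intro sum.cong refl) (simp add: **)
qed

text \<open>Halving a cell changes only the term of its right half, where \<open>f\<close> moves
  from the left end to the midpoint. This is a product of two increments at level l + 1, at most
  \<open>a (Suc l)\<close> / 2^(l+1), and at most (t - s) 2^l + 2 cells contribute.\<close>

lemma dyadic_sum_refine:
  assumes st: "0 \<le> s" "s \<le> t" "t \<le> 1"
  shows "norm (dyadic_sum (Suc l) s t - dyadic_sum l s t)
    \<le> ((t - s) / 2 + 1 / 2 ^ l) * a (Suc l)"
proof -
  let ?c = "clip s t"
  define e where "e k = B (f ((real (2 * k) + 1) / 2 ^ Suc l) - f (real (2 * k) / 2 ^ Suc l))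
    (g (?c ((real (2 * k) + 2) / 2 ^ Suc l)) - g (?c ((real (2 * k) + 1) / 2 ^ Suc l)))" for k
  have half: "real k / 2 ^ l = real (2 * k) / 2 ^ Suc l"
    "(real k + 1) / 2 ^ l = (real (2 * k) + 2) / 2 ^ Suc l" for k
    by (simp_all add: field_simps)
  have suc: "real (2 * k + 1) = real (2 * k) + 1" "real (2 * k) + 1 + 1 = real (2 * k) + 2" for k
    by simp_all
  have double: "(\<Sum>k<2 ^ Suc l. F k) = (\<Sum>k<2 ^ l. F (2 * k) + F (2 * k + 1))" for F :: "nat \<Rightarrow> 'c"
    using sum_lessThan_double[of F "2 ^ l"] by simp
  have "dyadic_sum (Suc l) s t - dyadic_sum l s t = (\<Sum>k<2 ^ l. e k)"
    unfolding dyadic_sum_def double sum_subtractf[symmetric]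
      half e_def suc
    by (intro sum.cong refl) (simp add: diff_left diff_right algebra_simps)
  also have "norm \<dots> \<le> ((t - s) / (1 / 2 ^ l) + 2) * (a (Suc l) / 2 ^ Suc l)"
  proof (rule norm_sum_grid_le)
    fix k :: nat assume k: "k < 2 ^ l"
    then have "real k + 1 \<le> 2 ^ l"
      by (metis Suc_leI numeral_power_eq_of_nat_cancel_iff of_nat_Suc of_nat_mono add.commute)
    then show "norm (e k) \<le> a (Suc l) / 2 ^ Suc l"
      unfolding e_def
      by (intro norm_B_le clip_in st order_trans[OF clip_diff_le])
        (use less_imp_le[OF k] in \<open>auto simp: field_simps st\<close>)
  next
    fix k :: nat
    assume k: "t \<le> real k * (1 / 2 ^ l) \<or> (real k + 1) * (1 / 2 ^ l) \<le> s"
    have "?c ((real (2 * k) + 2) / 2 ^ Suc l) = ?c ((real (2 * k) + 1) / 2 ^ Suc l)"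
      using k st(2) by (intro clip_eq) (auto simp: field_simps)
    then show "e k = 0"
      by (simp add: e_def zero_right)
  qed (use st a_nonneg[of "Suc l"] in auto)
  also have "\<dots> = ((t - s) / 2 + 1 / 2 ^ l) * a (Suc l)"
    by (simp add: field_simps)
  finally show ?thesis .
qed

text \<open>Replacing \<open>f\<close> at the grid points by \<open>f s\<close> costs at most
  \<open>a N\<close> / 2^N on each of at most (t - s) 2^N + 2 cells. As 2^-N is at most 2 (t - s),
  the total is at most 5 (t - s) \<open>a N\<close>, within the stated 6.\<close>

lemma dyadic_sum_coarse:
  assumes st: "0 \<le> s" "s \<le> t" "t \<le> 1" and N: "t - s \<le> 1 / 2 ^ N" "1 / 2 ^ N \<le> 2 * (t - s)"
  shows "norm (dyadic_sum N s t - B (f s) (g t - g s)) \<le> 6 * a N * (t - s)"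
proof -
  let ?c = "clip s t" and ?H = "1 / 2 ^ N :: real"
  define e where "e k = B (f (real k / 2 ^ N) - f s)
    (g (?c ((real k + 1) / 2 ^ N)) - g (?c (real k / 2 ^ N)))" for k
  \<comment> \<open>Clipping sends the grid ends 0 and 1 to \<open>s\<close> and
    \<open>t\<close>.\<close>
  have "(\<Sum>k<2 ^ N. g (?c ((real k + 1) / 2 ^ N)) - g (?c (real k / 2 ^ N))) = g t - g s"
    using sum_lessThan_telescope[of "\<lambda>k. g (?c (real k / 2 ^ N))" "2 ^ N"] st
    by (simp add: add.commute clip_def)
  then have "B (f s) (g t - g s) = (\<Sum>k<2 ^ N. B (f s) (g (?c ((real k + 1) / 2 ^ N)) - g (?c (real k / 2 ^ N))))"
    by (metis sum_right)
  then have "dyadic_sum N s t - B (f s) (g t - g s) = (\<Sum>k<2 ^ N. e k)"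
    by (simp add: dyadic_sum_def e_def diff_left flip: sum_subtractf)
  also have "norm \<dots> \<le> ((t - s) / ?H + 2) * (a N / 2 ^ N)"
  proof (rule norm_sum_grid_le)
    fix k :: nat assume k: "k < 2 ^ N" "real k * ?H < t" "s < (real k + 1) * ?H"
    then have "real k / 2 ^ N \<le> 1" by simp
    \<comment> \<open>The cell reaches beyond \<open>s\<close>, so its left end is at most one cell
      width below \<open>s\<close>; it starts before \<open>t\<close>, which is at most one width
      above \<open>s\<close>.\<close>
    moreover have "\<bar>real k / 2 ^ N - s\<bar> \<le> ?H"
      using k N(1) by (simp add: abs_le_iff add_divide_distrib)
    ultimately show "norm (e k) \<le> a N / 2 ^ N"
      unfolding e_def using st
      by (intro norm_B_le clip_in st order_trans[OF clip_diff_le])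
        (auto simp: field_simps)
  next
    fix k :: nat
    assume k: "t \<le> real k * ?H \<or> (real k + 1) * ?H \<le> s"
    have "?c ((real k + 1) / 2 ^ N) = ?c (real k / 2 ^ N)"
      using k st(2) by (intro clip_eq) (auto simp: field_simps)
    then show "e k = 0"
      by (simp add: e_def zero_right)
  qed (use st a_nonneg[of N] in auto)
  also have "\<dots> = ((t - s) + 2 * ?H) * a N"
    by (simp add: field_simps)
  also have "\<dots> \<le> (6 * (t - s)) * a N"
    using N st by (intro mult_right_mono a_nonneg) (simp add: field_simps)
  finally show ?thesis by (simp add: mult_ac)
qed

definition dyadic_limit :: "real \<Rightarrow> 'c" where
  "dyadic_limit t = lim (\<lambda>l. dyadic_sum l 0 t)"

text \<open>On [0, t] the refinement error is at most (1/2 + 1) \<open>a (Suc l)\<close>, so the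
  telescoping series converges by comparison and completeness.\<close>

lemma dyadic_sum_tendsto_dyadic_limit:
  assumes t: "t \<in> {0..1}"
  shows "(\<lambda>l. dyadic_sum l 0 t) \<longlonglongrightarrow> dyadic_limit t"
proof -
  have "summable (\<lambda>l. dyadic_sum (Suc l) 0 t - dyadic_sum l 0 t)"
  proof (rule summable_comparison_test')
    show "summable (\<lambda>l. 2 * a (Suc l))"
      using summable_a by (simp add: summable_Suc_iff summable_mult)
    fix l
    have "norm (dyadic_sum (Suc l) 0 t - dyadic_sum l 0 t) \<le> ((t - 0) / 2 + 1 / 2 ^ l) * a (Suc l)"
      using t by (intro dyadic_sum_refine) auto
    also have "(t - 0) / 2 + 1 / 2 ^ l \<le> 1 / 2 + 1"
      using t by (intro add_mono) auto
    then have "((t - 0) / 2 + 1 / 2 ^ l) * a (Suc l) \<le> 2 * a (Suc l)"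
      by (intro mult_right_mono a_nonneg) simp
    finally show "norm (dyadic_sum (Suc l) 0 t - dyadic_sum l 0 t) \<le> 2 * a (Suc l)" .
  qed
  then have "convergent (\<lambda>n. dyadic_sum n 0 t - dyadic_sum 0 0 t)"
    unfolding summable_iff_convergent sum_lessThan_telescope[of "\<lambda>l. dyadic_sum l 0 t"] .
  then have "convergent (\<lambda>n. dyadic_sum n 0 t)"
    by (simp add: convergent_diff_const_right_iff)
  then show ?thesis
    unfolding dyadic_limit_def by (rule convergent_LIMSEQ_iff[THEN iffD1])
qed

lemma dyadic_limit_0: "dyadic_limit 0 = 0"
proof -
  have "dyadic_sum l 0 0 = 0" for l
    by (simp add: dyadic_sum_def clip_def max_def min_def zero_right)
  then show ?thesis by (simp add: dyadic_limit_def)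
qed

text \<open>Starting at a level \<open>N\<close> matched to \<open>t - s\<close>, the coarse
  comparison and all later refinements are linear in \<open>t - s\<close>. The bound is uniform in
  the level and passes to the limit.\<close>

lemma dyadic_limit_diff_le:
  assumes st: "0 \<le> s" "s < t" "t \<le> 1" and N: "t - s \<le> 1 / 2 ^ N" "1 / 2 ^ N \<le> 2 * (t - s)"
  shows "norm (dyadic_limit t - dyadic_limit s - B (f s) (g t - g s))
    \<le> (6 * a N + 5 / 2 * suminf (\<lambda>l. a (Suc (l + N)))) * (t - s)"
proof -
  have summ: "summable (\<lambda>l. a (Suc (l + N)))"
    using summable_ignore_initial_segment[OF summable_a, of "Suc N"] by simp
  have lim: "(\<lambda>n. dyadic_sum (n + N) s t) \<longlonglongrightarrow> dyadic_limit t - dyadic_limit s"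
  proof -
    have "(\<lambda>n. dyadic_sum n 0 t - dyadic_sum n 0 s) \<longlonglongrightarrow> dyadic_limit t - dyadic_limit s"
      using st by (intro tendsto_diff dyadic_sum_tendsto_dyadic_limit) auto
    then show ?thesis
      using st by (subst (asm) dyadic_sum_diff) (auto intro: LIMSEQ_ignore_initial_segment)
  qed
  have step: "norm (dyadic_sum (Suc (l + N)) s t - dyadic_sum (l + N) s t)
      \<le> (5 / 2 * (t - s)) * a (Suc (l + N))" for l
  proof -
    have "norm (dyadic_sum (Suc (l + N)) s t - dyadic_sum (l + N) s t)
      \<le> ((t - s) / 2 + 1 / 2 ^ (l + N)) * a (Suc (l + N))"
      using st by (intro dyadic_sum_refine) auto
    \<comment> \<open>With 2^-N at most 2 (t - s), the factor becomes (1/2 + 2) (t - s), the source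
      of 5/2.\<close>
    also have "1 / 2 ^ (l + N) \<le> (1 / 2 ^ N :: real)"
      by (simp add: field_simps power_add)
    then have "((t - s) / 2 + 1 / 2 ^ (l + N)) * a (Suc (l + N)) \<le> (5 / 2 * (t - s)) * a (Suc (l + N))"
      using N by (intro mult_right_mono a_nonneg) linarith
    finally show ?thesis .
  qed
  have "norm (dyadic_sum (n + N) s t - B (f s) (g t - g s))
      \<le> (6 * a N + 5 / 2 * suminf (\<lambda>l. a (Suc (l + N)))) * (t - s)" for n
  proof -
    have "norm (dyadic_sum (n + N) s t - dyadic_sum N s t)
        = norm (\<Sum>l<n. dyadic_sum (Suc (l + N)) s t - dyadic_sum (l + N) s t)"
      using sum_lessThan_telescope[of "\<lambda>l. dyadic_sum (l + N) s t" n] by simp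
    also have "\<dots> \<le> (\<Sum>l<n. (5 / 2 * (t - s)) * a (Suc (l + N)))"
      using step by (rule sum_norm_le)
    also have "\<dots> = (5 / 2 * (t - s)) * (\<Sum>l<n. a (Suc (l + N)))"
      by (simp add: sum_distrib_left)
    also have "\<dots> \<le> (5 / 2 * (t - s)) * suminf (\<lambda>l. a (Suc (l + N)))"
      using st by (intro mult_left_mono sum_le_suminf summ) (auto simp: a_nonneg)
    finally have "norm (dyadic_sum (n + N) s t - dyadic_sum N s t) \<le> \<dots>" .
    moreover have "norm (dyadic_sum N s t - B (f s) (g t - g s)) \<le> 6 * a N * (t - s)"
      using st N by (intro dyadic_sum_coarse) auto
    moreover have "norm (dyadic_sum (n + N) s t - B (f s) (g t - g s)) \<le>
      norm (dyadic_sum (n + N) s t - dyadic_sum N s t) + norm (dyadic_sum N s t - B (f s) (g t - g s))"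
      using norm_triangle_ineq[of "dyadic_sum (n + N) s t - dyadic_sum N s t" "dyadic_sum N s t - B (f s) (g t - g s)"]
      by simp
    ultimately have "norm (dyadic_sum (n + N) s t - B (f s) (g t - g s))
        \<le> (5 / 2 * (t - s)) * suminf (\<lambda>l. a (Suc (l + N))) + 6 * a N * (t - s)"
      by linarith
    then show ?thesis
      by (simp only: distrib_right distrib_left mult_ac add.commute)
  qed
  moreover have "(\<lambda>n. norm (dyadic_sum (n + N) s t - B (f s) (g t - g s)))
      \<longlonglongrightarrow> norm (dyadic_limit t - dyadic_limit s - B (f s) (g t - g s))"
    by (intro tendsto_intros lim)
  ultimately show ?thesis
    by (intro LIMSEQ_le_const2) auto
qed

text \<open>On each cell the Riemann term differs from the increment of \<open>dyadic_limit\<close>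
  by at most a small multiple of the cell length, and the lengths add up to
  \<open>t \<le> 1\<close>.\<close>

lemma has_RS_integral_dyadic_limit:
  assumes t: "t \<in> {0..1}"
  shows "has_RS_integral B f g 0 t (dyadic_limit t)"
  unfolding has_RS_integral_def
proof (intro allI impI)
  fix \<epsilon> :: real assume \<epsilon>: "\<epsilon> > 0"
  \<comment> \<open>The 8 covers 6 from \<open>dyadic_limit_diff_le\<close> plus 2 for moving the
    tag to the left end, and exceeds the 5/2 on the tail. Monotonicity of \<open>Q\<close> later
    replaces the level of each cell by the common \<open>M\<close>.\<close>
  define Q where "Q N = 8 * suminf (\<lambda>l. a (l + N))" for N
  have summ: "summable (\<lambda>l. a (l + N))" for N
    using summable_ignore_initial_segment[OF summable_a] .
  have Q_Suc: "Q N = 8 * a N + 8 * suminf (\<lambda>l. a (Suc (l + N)))" for N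
    unfolding Q_def using suminf_split_head[OF summ[of N]] by simp
  have tail: "0 \<le> suminf (\<lambda>l. a (Suc (l + N)))" for N
    using summ[of "Suc N"] by (intro suminf_nonneg) (auto simp: a_nonneg)
  have "decseq Q"
    unfolding decseq_Suc_iff using Q_Suc a_nonneg by (simp add: Q_def)
  have "Q \<longlonglongrightarrow> 8 * 0"
    unfolding Q_def using suminf_exist_split2[OF summable_a] by (intro tendsto_intros)
  then have "\<forall>\<^sub>F N in sequentially. Q N < \<epsilon>"
    using \<epsilon> by (intro order_tendstoD(2)) auto
  then obtain M where M: "Q M < \<epsilon>"
    by (auto simp: eventually_sequentially)
  have Q0: "0 \<le> Q M"
    using Q_Suc[of M] a_nonneg[of M] tail[of M] by simp
  show "\<exists>\<delta>>0. \<forall>n \<tau> \<xi>. finite_partition 0 t n \<tau> \<longrightarrow>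
        (\<forall>j<n. \<tau> (Suc j) - \<tau> j < \<delta>) \<longrightarrow> (\<forall>j<n. \<xi> j \<in> {\<tau> j..\<tau> (Suc j)}) \<longrightarrow>
        norm ((\<Sum>j<n. B (f (\<xi> j)) (g (\<tau> (Suc j)) - g (\<tau> j))) - dyadic_limit t) < \<epsilon>"
  proof (rule exI[of _ "1 / 2 ^ M"], intro conjI allI impI)
    fix n \<tau> \<xi>
    assume P: "finite_partition 0 t n \<tau>" and mesh: "\<forall>j<n. \<tau> (Suc j) - \<tau> j < 1 / 2 ^ M"
      and tag: "\<forall>j<n. \<xi> j \<in> {\<tau> j..\<tau> (Suc j)}"
    have local: "norm (B (f (\<xi> j)) (g (\<tau> (Suc j)) - g (\<tau> j)) - (dyadic_limit (\<tau> (Suc j)) - dyadic_limit (\<tau> j)))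
        \<le> Q M * (\<tau> (Suc j) - \<tau> j)" if j: "j < n" for j
    proof -
      define u v where "u = \<tau> j" and "v = \<tau> (Suc j)"
      have uv: "0 \<le> u" "u < v" "v \<le> 1" "v - u < 1 / 2 ^ M" "\<xi> j \<in> {u..v}"
        using finite_partition_bounds[OF P, of j] finite_partition_bounds[OF P, of "Suc j"] P tag mesh t j
        by (auto simp: u_def v_def finite_partition_def)
      obtain N where N: "v - u \<le> 1 / 2 ^ N" "1 / 2 ^ N < 2 * (v - u)"
        using exists_dyadic_scale[of "v - u"] uv by auto
      \<comment> \<open>A cell shorter than 2^-M has a matching level no coarser than
        \<open>M\<close>.\<close>
      have "1 / 2 ^ N < (2 / 2 ^ M :: real)"
        using N(2) uv(4) by simp
      then have "(2::real) ^ M < 2 ^ Suc N"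
        by (simp add: field_simps)
      then have "M \<le> N"
        by (simp only: power_strict_increasing_iff less_Suc_eq_le)
      have "norm (B (f (\<xi> j) - f u) (g v - g u)) \<le> a N / 2 ^ N"
        using uv N by (intro norm_B_le) auto
      also have "\<dots> \<le> a N * (2 * (v - u))"
        using N(2) mult_left_mono[OF less_imp_le[OF N(2)] a_nonneg[of N]] by simp
      finally have 1: "norm (B (f (\<xi> j) - f u) (g v - g u)) \<le> 2 * a N * (v - u)"
        by (simp only: mult_ac)
      have 2: "norm (dyadic_limit v - dyadic_limit u - B (f u) (g v - g u))
          \<le> (6 * a N + 5 / 2 * suminf (\<lambda>l. a (Suc (l + N)))) * (v - u)"
        using uv N by (intro dyadic_limit_diff_le) auto
      have "norm (B (f (\<xi> j)) (g v - g u) - (dyadic_limit v - dyadic_limit u)) =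
          norm (B (f (\<xi> j) - f u) (g v - g u) - (dyadic_limit v - dyadic_limit u - B (f u) (g v - g u)))"
        by (simp add: diff_left)
      also have "\<dots> \<le> norm (B (f (\<xi> j) - f u) (g v - g u)) + norm (dyadic_limit v - dyadic_limit u - B (f u) (g v - g u))"
        by (rule norm_triangle_ineq4)
      also have "\<dots> \<le> (8 * a N + 5 / 2 * suminf (\<lambda>l. a (Suc (l + N)))) * (v - u)"
        using 1 2 by (simp add: algebra_simps)
      also have "\<dots> \<le> Q N * (v - u)"
        using uv tail[of N] by (intro mult_right_mono) (auto simp: Q_Suc)
      also have "\<dots> \<le> Q M * (v - u)"
        using uv \<open>M \<le> N\<close> \<open>decseq Q\<close> by (intro mult_right_mono) (auto simp: decseq_def)
      finally show ?thesis by (simp add: u_def v_def)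
    qed
    have "(\<Sum>j<n. B (f (\<xi> j)) (g (\<tau> (Suc j)) - g (\<tau> j))) - dyadic_limit t =
        (\<Sum>j<n. B (f (\<xi> j)) (g (\<tau> (Suc j)) - g (\<tau> j)) - (dyadic_limit (\<tau> (Suc j)) - dyadic_limit (\<tau> j)))"
      using finite_partition_telescope[OF P, of dyadic_limit] by (simp add: sum_subtractf dyadic_limit_0)
    also have "norm \<dots> \<le> (\<Sum>j<n. Q M * (\<tau> (Suc j) - \<tau> j))"
      using local by (intro sum_norm_le) auto
    also have "\<dots> = Q M * t"
      using finite_partition_telescope[OF P, of "\<lambda>x. x"] by (simp flip: sum_distrib_left)
    also have "\<dots> \<le> Q M"
      using Q0 t by (simp add: mult_left_le)
    finally show "norm ((\<Sum>j<n. B (f (\<xi> j)) (g (\<tau> (Suc j)) - g (\<tau> j))) - dyadic_limit t) < \<epsilon>"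
      using M by linarith
  qed simp
qed

end

section \<open>Dyadic values of a monotone function against its logarithmic integral\<close>

lemma inverse_power_2_in: "1 / 2 ^ l \<in> {0..1::real}"
  by simp

text \<open>On (2^-(l+1), 2^-l] the function \<open>\<mu>\<close> is at least its value at the left
  end and 1/t is at least 2^l. The length 2^-(l+1) leaves half of that value, hence the factor 2.
  The sum starts at 1/2 because 1 is not the left end of such an interval.\<close>

lemma sum_dyadic_le_nn_integral:
  fixes \<mu> :: "real \<Rightarrow> real"
  assumes mono: "mono_on {0..1} \<mu>" and nonneg: "\<And>t. t \<in> {0..1} \<Longrightarrow> 0 \<le> \<mu> t"
  shows "ennreal (\<Sum>l<n. \<mu> (1 / 2 ^ Suc l)) \<le> 2 * (\<integral>\<^sup>+ t\<in>{0..1}. ennreal (\<mu> t / t) \<partial>lborel)"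
proof -
  define A where "A l = {1 / 2 ^ Suc l <.. 1 / 2 ^ l :: real}" for l :: nat
  define c where "c l = \<mu> (1 / 2 ^ Suc l) * 2 ^ l" for l :: nat
  have c: "0 \<le> c l" "0 \<le> \<mu> (1 / 2 ^ Suc l)" for l
    using nonneg[OF inverse_power_2_in, of "Suc l"] by (simp_all add: c_def)
  have disj: "l = k" if "t \<in> A l" "t \<in> A k" for t l k
  proof (rule ccontr)
    assume "l \<noteq> k"
    have *: "1 / 2 ^ j \<le> (1 / 2 ^ Suc i :: real)" if "i < j" for i j :: nat
      using that by (intro divide_left_mono power_increasing) auto
    show False
      using \<open>l \<noteq> k\<close> that *[of l k] *[of k l] unfolding A_def
      by (cases "l < k") fastforce+
  qed
  \<comment> \<open>The half-open intervals are disjoint, so at most one term of the step function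
    is nonzero at \<open>t\<close>.\<close>
  have pt: "(\<Sum>l<n. ennreal (c l) * indicator (A l) t) \<le> ennreal (\<mu> t / t) * indicator {0..1} t" for t
  proof (cases "\<exists>k<n. t \<in> A k")
    case True
    then obtain k where k: "k < n" "t \<in> A k" by blast
    have t: "1 / 2 ^ Suc k < t" "t \<le> 1 / 2 ^ k"
      using k by (auto simp: A_def)
    have "0 < (1 / 2 ^ Suc k :: real)" "1 / 2 ^ k \<le> (1 :: real)"
      by simp_all
    then have t': "0 < t" "t \<le> 1"
      using t by linarith+
    have "(\<Sum>l<n. ennreal (c l) * indicator (A l) t) = (\<Sum>l\<in>{k}. ennreal (c l) * indicator (A l) t)"
      using k disj by (intro sum.mono_neutral_right) (auto simp: indicator_def)
    also have "\<dots> = ennreal (c k)"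
      using k by simp
    also have "c k \<le> \<mu> t / t"
    proof -
      have "\<mu> (1 / 2 ^ Suc k) \<le> \<mu> t"
        using t t' by (intro mono_onD[OF mono inverse_power_2_in]) auto
      moreover have "2 ^ k \<le> 1 / t"
        using t t' by (simp add: field_simps)
      ultimately have "\<mu> (1 / 2 ^ Suc k) * 2 ^ k \<le> \<mu> t * (1 / t)"
        using t' by (intro mult_mono nonneg) auto
      then show ?thesis
        by (simp add: c_def)
    qed
    then have "ennreal (c k) \<le> ennreal (\<mu> t / t)"
      by (rule ennreal_leI)
    finally show ?thesis
      using t' by simp
  next
    case False
    then have "(\<Sum>l<n. ennreal (c l) * indicator (A l) t) = 0"
      by (intro sum.neutral) (auto simp: indicator_def)
    then show ?thesis by simp
  qed
  have "ennreal (\<Sum>l<n. \<mu> (1 / 2 ^ Suc l)) = 2 * (\<Sum>l<n. ennreal (\<mu> (1 / 2 ^ Suc l) / 2))"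
  proof -
    have "(\<Sum>l<n. \<mu> (1 / 2 ^ Suc l)) = 2 * (\<Sum>l<n. \<mu> (1 / 2 ^ Suc l) / 2)"
      by (simp add: sum_distrib_left)
    then show ?thesis
      using c by (subst sum_ennreal) (simp_all add: ennreal_mult sum_nonneg)
  qed
  also have "(\<Sum>l<n. ennreal (\<mu> (1 / 2 ^ Suc l) / 2)) = (\<Sum>l<n. ennreal (c l) * emeasure lborel (A l))"
  proof (intro sum.cong refl)
    fix l
    have "emeasure lborel (A l) = ennreal (1 / 2 ^ Suc l)"
      by (simp add: A_def field_simps)
    then show "ennreal (\<mu> (1 / 2 ^ Suc l) / 2) = ennreal (c l) * emeasure lborel (A l)"
      using c[of l] by (simp add: c_def flip: ennreal_mult)
  qed
  also have "\<dots> = (\<integral>\<^sup>+ t. (\<Sum>l<n. ennreal (c l) * indicator (A l) t) \<partial>lborel)"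
    by (subst nn_integral_sum) (auto simp: A_def nn_integral_cmult_indicator)
  also have "\<dots> \<le> (\<integral>\<^sup>+ t\<in>{0..1}. ennreal (\<mu> t / t) \<partial>lborel)"
    by (intro nn_integral_mono pt)
  finally show ?thesis
    by (simp add: mult_left_mono)
qed

lemma summable_dyadic:
  fixes \<mu> :: "real \<Rightarrow> real"
  defines "J \<equiv> (\<integral>\<^sup>+ t\<in>{0..1}. ennreal (\<mu> t / t) \<partial>lborel)"
  assumes mono: "mono_on {0..1} \<mu>" and nonneg: "\<And>t. t \<in> {0..1} \<Longrightarrow> 0 \<le> \<mu> t"
    and J: "J < top"
  shows "summable (\<lambda>l. \<mu> (1 / 2 ^ Suc l))" (is ?summ)
    and "suminf (\<lambda>l. \<mu> (1 / 2 ^ Suc l)) \<le> 2 * enn2real J" (is ?le)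
proof -
  have pos: "0 \<le> \<mu> (1 / 2 ^ Suc l)" for l :: nat
    by (rule nonneg[OF inverse_power_2_in])
  have le: "(\<Sum>l<n. \<mu> (1 / 2 ^ Suc l)) \<le> 2 * enn2real J" for n
  proof -
    have "ennreal (\<Sum>l<n. \<mu> (1 / 2 ^ Suc l)) \<le> 2 * J"
      unfolding J_def using mono nonneg by (rule sum_dyadic_le_nn_integral)
    also have "\<dots> = ennreal (2 * enn2real J)"
      using J by (simp add: ennreal_mult)
    finally show ?thesis
      by (subst (asm) ennreal_le_iff) auto
  qed
  then show ?summ
    using pos by (rule_tac summableI_nonneg_bounded[where x = "2 * enn2real J"]) auto
  then show ?le
    using le by (rule suminf_le_const)
qed

section \<open>Estimates for the two paths and the variation bound\<close>

text \<open>Both factors of the modulus are nondecreasing, so the distance may be enlarged to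
  \<open>H\<close>; swapping endpoints covers \<open>t < s\<close>.\<close>

lemma norm_diff_le_scale:
  assumes mono: "mono_on {0..1} m" and nonneg: "\<And>t. t \<in> {0..1} \<Longrightarrow> 0 \<le> m t"
    and fin: "modulus_const p m \<gamma> < top" and p: "p > 1"
    and st: "s \<in> {0..1}" "t \<in> {0..1}" and H: "\<bar>t - s\<bar> \<le> H" "H \<le> 1"
  shows "norm (\<gamma> t - \<gamma> s) \<le> enn2real (modulus_const p m \<gamma>) * (H powr (1 / p) * m H)"
proof -
  have H0: "0 \<le> H" "H \<in> {0..1}"
    using H by auto
  have lt: "norm (\<gamma> t - \<gamma> s) \<le> enn2real (modulus_const p m \<gamma>) * (H powr (1 / p) * m H)"
    if "0 \<le> s" "s < t" "t \<le> 1" "t - s \<le> H" for s t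
  proof -
    have d: "t - s \<in> {0..1}"
      using that by auto
    have "norm (\<gamma> t - \<gamma> s) \<le> enn2real (modulus_const p m \<gamma>) * ((t - s) powr (1 / p) * m (t - s))"
      using fin that nonneg[OF d] by (intro norm_diff_le_modulus_const) auto
    also have "\<dots> \<le> enn2real (modulus_const p m \<gamma>) * (H powr (1 / p) * m H)"
      using that p d nonneg[OF d] H0
      by (intro mult_left_mono mult_mono powr_mono2 mono_onD[OF mono]) auto
    finally show ?thesis .
  qed
  consider "s < t" | "t < s" | "s = t" by linarith
  then show ?thesis
  proof cases
    case 1
    then show ?thesis using st H by (intro lt) auto
  next
    case 2
    then show ?thesis
      using st H by (subst norm_minus_commute, intro lt) auto
  next
    case 3
    then show ?thesis
      using nonneg[OF H0(2)] by simp
  qed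
qed

text \<open>The variation bound is stated for paths with \<open>\<gamma>\<^sub>1 0 = 0\<close>:
  adding a constant v to \<open>\<gamma>\<^sub>1\<close> leaves the right side unchanged but adds v
  tensored with the increment of \<open>\<gamma>\<^sub>2\<close> to the integral.\<close>

theorem theorem29:
  fixes \<iota> :: "('a::banach, 'b::banach) tensor \<Rightarrow> 'c::banach"
    and \<gamma>\<^sub>1 :: "real \<Rightarrow> 'a" and \<gamma>\<^sub>2 :: "real \<Rightarrow> 'b"
    and p q :: real and m\<^sub>1 m\<^sub>2 :: "real \<Rightarrow> real"
  defines "C\<^sub>1 \<equiv> modulus_const p m\<^sub>1 \<gamma>\<^sub>1"
    and "C\<^sub>2 \<equiv> modulus_const q m\<^sub>2 \<gamma>\<^sub>2"
    and "J \<equiv> (\<integral>\<^sup>+ t\<in>{0..1}. ennreal (m\<^sub>1 t * m\<^sub>2 t / t) \<partial>lborel)"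
  assumes "tensor_completion \<iota>"
    and "continuous_on {0..1} \<gamma>\<^sub>1" and "continuous_on {0..1} \<gamma>\<^sub>2"
    and "p > 1" and "q > 1" and "1 / p + 1 / q = 1"
    and "mono_on {0..1} m\<^sub>1" and "mono_on {0..1} m\<^sub>2"
    and "\<And>t. t \<in> {0..1} \<Longrightarrow> 0 \<le> m\<^sub>1 t" and "\<And>t. t \<in> {0..1} \<Longrightarrow> 0 \<le> m\<^sub>2 t"
    and "(m\<^sub>1 \<longlongrightarrow> 0) (at_right 0)" and "(m\<^sub>2 \<longlongrightarrow> 0) (at_right 0)"
    and "m\<^sub>1 1 \<le> 1" and "m\<^sub>2 1 \<le> 1"
    and "J < top" and "C\<^sub>1 < top" and "C\<^sub>2 < top"
  shows "(\<forall>t\<in>{0..1}. RS_integrable (\<lambda>v u. \<iota> (v \<otimes>\<^sub>t u)) \<gamma>\<^sub>1 \<gamma>\<^sub>2 0 t) \<and>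
    (\<gamma>\<^sub>1 0 = 0 \<longrightarrow>
      q_variation q (\<lambda>t. RS_integral (\<lambda>v u. \<iota> (v \<otimes>\<^sub>t u)) \<gamma>\<^sub>1 \<gamma>\<^sub>2 0 t) \<le> 8 * C\<^sub>1 * C\<^sub>2 * (2 + J))"
proof -
  let ?B = "\<lambda>v u. \<iota> (v \<otimes>\<^sub>t u)"
  note m1 = \<open>mono_on {0..1} m\<^sub>1\<close> \<open>\<And>t. t \<in> {0..1} \<Longrightarrow> 0 \<le> m\<^sub>1 t\<close>
  note m2 = \<open>mono_on {0..1} m\<^sub>2\<close> \<open>\<And>t. t \<in> {0..1} \<Longrightarrow> 0 \<le> m\<^sub>2 t\<close>
  define c\<^sub>1 c\<^sub>2 j where "c\<^sub>1 = enn2real C\<^sub>1" and "c\<^sub>2 = enn2real C\<^sub>2" and "j = enn2real J"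
  have c: "c\<^sub>1 \<ge> 0" "c\<^sub>2 \<ge> 0" "j \<ge> 0"
    by (simp_all add: c\<^sub>1_def c\<^sub>2_def j_def)
  define \<mu> where "\<mu> t = m\<^sub>1 t * m\<^sub>2 t" for t
  have \<mu>_mono: "mono_on {0..1} \<mu>"
    unfolding \<mu>_def using m1 m2 by (intro mono_onI mult_mono) (auto intro: mono_onD)
  have \<mu>_nonneg: "0 \<le> \<mu> t" if "t \<in> {0..1}" for t
    using m1(2) m2(2) that by (simp add: \<mu>_def)
  have J_eq: "(\<integral>\<^sup>+ t\<in>{0..1}. ennreal (\<mu> t / t) \<partial>lborel) = J"
    by (simp add: J_def \<mu>_def)
  note summ = summable_dyadic[OF \<mu>_mono \<mu>_nonneg, unfolded J_eq, OF _ \<open>J < top\<close>]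
  define a where "a l = c\<^sub>1 * c\<^sub>2 * \<mu> (1 / 2 ^ l)" for l :: nat
  define \<phi> \<psi> where "\<phi> l = c\<^sub>1 * ((1 / 2 ^ l) powr (1 / p) * m\<^sub>1 (1 / 2 ^ l))"
    and "\<psi> l = c\<^sub>2 * ((1 / 2 ^ l) powr (1 / q) * m\<^sub>2 (1 / 2 ^ l))" for l :: nat
  have tail: "suminf (\<lambda>l. a (Suc l)) \<le> c\<^sub>1 * c\<^sub>2 * (2 * j)"
    unfolding a_def using summ c by (subst suminf_mult) (auto simp: j_def intro!: mult_left_mono)
  interpret dyadic_integrands ?B \<gamma>\<^sub>1 \<gamma>\<^sub>2 \<phi> \<psi> a
  proof (intro dyadic_integrands.intro dyadic_integrands_axioms.intro)
    show "bounded_bilinear ?B"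
      using \<open>tensor_completion \<iota>\<close> by (rule bounded_bilinear_tensor_completion)
    show "norm (\<iota> (v \<otimes>\<^sub>t u)) \<le> norm v * norm u" for v u
      using \<open>tensor_completion \<iota>\<close> by (simp add: tensor_completion_def)
    show "norm (\<gamma>\<^sub>1 t - \<gamma>\<^sub>1 s) \<le> \<phi> l"
      if "s \<in> {0..1}" "t \<in> {0..1}" "\<bar>t - s\<bar> \<le> 1 / 2 ^ l" for s t l
      unfolding \<phi>_def c\<^sub>1_def C\<^sub>1_def
      using m1 \<open>C\<^sub>1 < top\<close> \<open>p > 1\<close> that by (intro norm_diff_le_scale) (auto simp: C\<^sub>1_def)
    show "norm (\<gamma>\<^sub>2 t - \<gamma>\<^sub>2 s) \<le> \<psi> l"
      if "s \<in> {0..1}" "t \<in> {0..1}" "\<bar>t - s\<bar> \<le> 1 / 2 ^ l" for s t l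
      unfolding \<psi>_def c\<^sub>2_def C\<^sub>2_def
      using m2 \<open>C\<^sub>2 < top\<close> \<open>q > 1\<close> that by (intro norm_diff_le_scale) (auto simp: C\<^sub>2_def)
    show "\<phi> l * \<psi> l \<le> a l / 2 ^ l" for l
    proof -
      \<comment> \<open>Conjugacy of \<open>p\<close> and \<open>q\<close> makes the two powers
        combine to exactly 2^-l.\<close>
      have "(1 / 2 ^ l) powr (1 / p) * (1 / 2 ^ l) powr (1 / q) = (1 / 2 ^ l :: real)"
        unfolding powr_add[symmetric] \<open>1 / p + 1 / q = 1\<close> by simp
      moreover have "\<phi> l * \<psi> l = a l * ((1 / 2 ^ l) powr (1 / p) * (1 / 2 ^ l) powr (1 / q))"
        by (simp only: \<phi>_def \<psi>_def a_def \<mu>_def mult_ac)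
      ultimately show ?thesis by simp
    qed
    have "summable (\<lambda>l. a (Suc l))"
      unfolding a_def using summ by (intro summable_mult) simp
    then show "summable a"
      by (simp add: summable_Suc_iff)
  qed
  have "RS_integrable ?B \<gamma>\<^sub>1 \<gamma>\<^sub>2 0 t" if "t \<in> {0..1}" for t
    unfolding RS_integrable_def using has_RS_integral_dyadic_limit[OF that] by blast
  moreover have "q_variation q (\<lambda>t. RS_integral ?B \<gamma>\<^sub>1 \<gamma>\<^sub>2 0 t) \<le> 8 * C\<^sub>1 * C\<^sub>2 * (2 + J)"
    if \<gamma>0: "\<gamma>\<^sub>1 0 = 0"
  proof -
    have eq: "RS_integral ?B \<gamma>\<^sub>1 \<gamma>\<^sub>2 0 t = dyadic_limit t" if "t \<in> {0..1}" for t
      using that has_RS_integral_dyadic_limit[OF that] by (intro RS_integral_eq) auto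
    have a_le: "a N \<le> c\<^sub>1 * c\<^sub>2" for N
    proof -
      have "\<mu> (1 / 2 ^ N) \<le> \<mu> 1"
        by (intro mono_onD[OF \<mu>_mono]) auto
      also have "\<dots> \<le> 1"
        unfolding \<mu>_def using m1(2)[of 1] m2(2)[of 1] \<open>m\<^sub>1 1 \<le> 1\<close> \<open>m\<^sub>2 1 \<le> 1\<close> by (intro mult_le_one) auto
      finally show ?thesis
        unfolding a_def using c by (intro mult_left_le) auto
    qed
    have tail_le: "suminf (\<lambda>l. a (Suc (l + N))) \<le> c\<^sub>1 * c\<^sub>2 * (2 * j)" for N
    proof -
      have s: "summable (\<lambda>l. a (Suc l))"
        using summable_a by (simp add: summable_Suc_iff)
      have "suminf (\<lambda>l. a (Suc l)) = suminf (\<lambda>l. a (Suc (l + N))) + (\<Sum>l<N. a (Suc l))"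
        using suminf_split_initial_segment[OF s, of N] by simp
      moreover have "0 \<le> (\<Sum>l<N. a (Suc l))"
        by (intro sum_nonneg a_nonneg)
      ultimately show ?thesis
        using tail by linarith
    qed
    \<comment> \<open>The starting value 0 turns the increment bound at scale 1 into a bound on the
      path itself.\<close>
    have f_bound: "norm (\<gamma>\<^sub>1 s) \<le> c\<^sub>1" if "s \<in> {0..1}" for s
    proof -
      have "norm (\<gamma>\<^sub>1 s - \<gamma>\<^sub>1 0) \<le> \<phi> 0"
        using that by (intro f_le) auto
      also have "\<phi> 0 \<le> c\<^sub>1"
        unfolding \<phi>_def using c \<open>m\<^sub>1 1 \<le> 1\<close> by (simp add: mult_left_le)
      finally show ?thesis
        by (simp add: \<gamma>0)
    qed
    have "q_variation q (\<lambda>t. RS_integral ?B \<gamma>\<^sub>1 \<gamma>\<^sub>2 0 t) \<le> ennreal (8 * c\<^sub>1 * c\<^sub>2 * (2 + j))"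
    proof (rule q_variation_le)
      fix s t :: real assume st: "0 \<le> s" "s < t" "t \<le> 1"
      define h where "h = (t - s) powr (1 / q)"
      obtain N where N: "t - s \<le> 1 / 2 ^ N" "1 / 2 ^ N < 2 * (t - s)"
        using exists_dyadic_scale[of "t - s"] st by auto
      \<comment> \<open>Lengths are at most 1 and 1/q is below 1, so errors linear in
        \<open>t - s\<close> are absorbed into \<open>h\<close>.\<close>
      have "(t - s) powr 1 \<le> h"
        unfolding h_def using st \<open>q > 1\<close> by (intro powr_mono') auto
      then have th: "t - s \<le> h"
        using st by simp
      have "norm (\<gamma>\<^sub>2 t - \<gamma>\<^sub>2 s) \<le> c\<^sub>2 * (h * m\<^sub>2 (t - s))"
        unfolding c\<^sub>2_def C\<^sub>2_def h_def
        using st m2(2)[of "t - s"] \<open>C\<^sub>2 < top\<close> by (intro norm_diff_le_modulus_const) (auto simp: C\<^sub>2_def)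
      also have "m\<^sub>2 (t - s) \<le> 1"
        using mono_onD[OF m2(1), of "t - s" 1] st \<open>m\<^sub>2 1 \<le> 1\<close> by auto
      then have "c\<^sub>2 * (h * m\<^sub>2 (t - s)) \<le> c\<^sub>2 * h"
        using c by (intro mult_left_mono mult_left_le) (auto simp: h_def)
      finally have g: "norm (\<gamma>\<^sub>2 t - \<gamma>\<^sub>2 s) \<le> c\<^sub>2 * h" .
      have "norm (?B (\<gamma>\<^sub>1 s) (\<gamma>\<^sub>2 t - \<gamma>\<^sub>2 s)) \<le> c\<^sub>1 * (c\<^sub>2 * h)"
        using norm_B by (rule order_trans) (intro mult_mono f_bound g c norm_ge_zero; use st in simp)
      moreover have "norm (dyadic_limit t - dyadic_limit s - ?B (\<gamma>\<^sub>1 s) (\<gamma>\<^sub>2 t - \<gamma>\<^sub>2 s)) \<le> (c\<^sub>1 * c\<^sub>2 * (6 + 5 * j)) * h"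
      proof -
        have "norm (dyadic_limit t - dyadic_limit s - ?B (\<gamma>\<^sub>1 s) (\<gamma>\<^sub>2 t - \<gamma>\<^sub>2 s))
            \<le> (6 * a N + 5 / 2 * suminf (\<lambda>l. a (Suc (l + N)))) * (t - s)"
          using st N by (intro dyadic_limit_diff_le) auto
        \<comment> \<open>The tail is at most twice \<open>j\<close> times the constants, and 5/2 of
          this gives 5 \<open>j\<close>.\<close>
        also have "\<dots> \<le> (c\<^sub>1 * c\<^sub>2 * (6 + 5 * j)) * (t - s)"
          using st a_le[of N] tail_le[of N] by (intro mult_right_mono) (auto simp: algebra_simps)
        also have "\<dots> \<le> (c\<^sub>1 * c\<^sub>2 * (6 + 5 * j)) * h"
          using c th by (intro mult_left_mono) auto
        finally show ?thesis .
      qed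
      moreover have "norm (dyadic_limit t - dyadic_limit s) \<le> norm (dyadic_limit t - dyadic_limit s - ?B (\<gamma>\<^sub>1 s) (\<gamma>\<^sub>2 t - \<gamma>\<^sub>2 s))
          + norm (?B (\<gamma>\<^sub>1 s) (\<gamma>\<^sub>2 t - \<gamma>\<^sub>2 s))"
        using norm_triangle_ineq[of "dyadic_limit t - dyadic_limit s - ?B (\<gamma>\<^sub>1 s) (\<gamma>\<^sub>2 t - \<gamma>\<^sub>2 s)" "?B (\<gamma>\<^sub>1 s) (\<gamma>\<^sub>2 t - \<gamma>\<^sub>2 s)"]
        by simp
      ultimately have "norm (dyadic_limit t - dyadic_limit s) \<le> (c\<^sub>1 * c\<^sub>2 * (6 + 5 * j)) * h + c\<^sub>1 * (c\<^sub>2 * h)"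
        by linarith
      also have "\<dots> = (c\<^sub>1 * c\<^sub>2 * h) * (7 + 5 * j)"
        by (simp add: algebra_simps)
      \<comment> \<open>The leading term raised 6 to 7, and 7 + 5 \<open>j\<close> lies below 16 + 8
        \<open>j\<close>.\<close>
      also have "\<dots> \<le> (c\<^sub>1 * c\<^sub>2 * h) * (8 * (2 + j))"
        using c by (intro mult_left_mono) (auto simp: h_def)
      also have "\<dots> = 8 * c\<^sub>1 * c\<^sub>2 * (2 + j) * h"
        by (simp only: mult_ac)
      finally show "norm (RS_integral ?B \<gamma>\<^sub>1 \<gamma>\<^sub>2 0 t - RS_integral ?B \<gamma>\<^sub>1 \<gamma>\<^sub>2 0 s)
          \<le> 8 * c\<^sub>1 * c\<^sub>2 * (2 + j) * (t - s) powr (1 / q)"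
        using st by (simp add: eq h_def)
    qed (use c \<open>q > 1\<close> in auto)
    also have "\<dots> = 8 * C\<^sub>1 * C\<^sub>2 * (2 + J)"
      using \<open>C\<^sub>1 < top\<close> \<open>C\<^sub>2 < top\<close> \<open>J < top\<close> c
      by (simp add: ennreal_mult ennreal_plus c\<^sub>1_def c\<^sub>2_def j_def)
    finally show ?thesis .
  qed
  ultimately show ?thesis by blast
qed

end
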